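(* Let $F$ be a vector lattice. Then: (1) $\{h\in F:\ I_h\text{ has PPP}\}$ is an ideal in $F$, and this ideal (as a vector lattice) has PPP; (2) $\{h\in F:\ I_h\text{ has PP}\}$ is an ideal in $F$, and this ideal has PP; (3) $\{h\in F:\ I_h\text{ has }\sigma\text{-PP}\}$ is an ideal in $F$, and this ideal has $\sigma$-PP.
   Context: An ideal of a vector lattice $F$ is a linear subspace $E\subset F$ such that $|f|\le|e|$, $e\in E$, $f\in F$ imply $f\in E$. For $h\in F$, $I_h$ is the smallest ideal of $F$ containing $h$, regarded as a vector lattice. For a subset $G$ of a vector lattice $E$, $G^d=\{f\in E:|f|\wedge|g|=0\text{ for all }g\in G\}$ and $G^{dd}=(G^d)^d$, computed in $E$. A band in $E$ is an ideal of $E$ that contains the supremum of any of its subsets whenever this supremum exists in $E$; it is countably generated if it is the smallest band containing some countable set. An ideal $H$ in $E$ is a projection band if $E=H+H^d$. $E$ has: the projection property (PP) if every band in $E$ is a projection band; the principal projection property (PPP) if $\{e\}^{dd}$ is a projection band for every $e\in E$; $\sigma$-PP if every countably generated band in $E$ is a projection band. *)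

theory Defs
  imports Complex_Main "HOL-Library.Lattice_Algebras" "HOL-Library.Lub_Glb"
    "HOL-Library.Countable_Set"
begin

(* Real vector lattices; the absolute value is \<bar>f\<bar> = sup f (- f). *)
class vector_lattice = ordered_real_vector + lattice_ab_group_add_abs

(* The ambient vector lattice F is the whole type. The vector lattices E occurring below are
   ideals of F, represented by their underlying sets. An ideal is closed under the linear and
   lattice operations of F, so these are also the operations of E. Arbitrary suprema, disjoint
   complements, ideals and bands, however, depend on E, and hence take E as a parameter. *)

definition ideal_in :: "'a::vector_lattice set \<Rightarrow> 'a set \<Rightarrow> bool" where
  "ideal_in E H \<longleftrightarrow> subspace H \<and> H \<subseteq> E \<and>
     (\<forall>f\<in>E. \<forall>h\<in>H. \<bar>f\<bar> \<le> \<bar>h\<bar> \<longrightarrow> f \<in> H)"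

definition principal_ideal :: "'a::vector_lattice \<Rightarrow> 'a set" where
  "principal_ideal h = ideal_in UNIV hull {h}"

definition disjoint_compl :: "'a::vector_lattice set \<Rightarrow> 'a set \<Rightarrow> 'a set" where
  "disjoint_compl E G = {f \<in> E. \<forall>g\<in>G. inf \<bar>f\<bar> \<bar>g\<bar> = 0}"

(* isLub E A s: s is the supremum of A in E, i.e. the least among the upper bounds of A that
   belong to E. *)
definition band_in :: "'a::vector_lattice set \<Rightarrow> 'a set \<Rightarrow> bool" where
  "band_in E H \<longleftrightarrow> ideal_in E H \<and> (\<forall>A s. A \<subseteq> H \<longrightarrow> isLub E A s \<longrightarrow> s \<in> H)"

definition countably_generated_band_in :: "'a::vector_lattice set \<Rightarrow> 'a set \<Rightarrow> bool" where
  "countably_generated_band_in E H \<longleftrightarrow>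
     (\<exists>C. countable C \<and> C \<subseteq> E \<and> H = band_in E hull C)"

definition projection_band_in :: "'a::vector_lattice set \<Rightarrow> 'a set \<Rightarrow> bool" where
  "projection_band_in E H \<longleftrightarrow> ideal_in E H \<and> E = {a + b | a b. a \<in> H \<and> b \<in> disjoint_compl E H}"

definition has_PP :: "'a::vector_lattice set \<Rightarrow> bool" where
  "has_PP E \<longleftrightarrow> (\<forall>H. band_in E H \<longrightarrow> projection_band_in E H)"

definition has_PPP :: "'a::vector_lattice set \<Rightarrow> bool" where
  "has_PPP E \<longleftrightarrow> (\<forall>e\<in>E. projection_band_in E (disjoint_compl E (disjoint_compl E {e})))"

definition has_sigma_PP :: "'a::vector_lattice set \<Rightarrow> bool" where
  "has_sigma_PP E \<longleftrightarrow> (\<forall>H. countably_generated_band_in E H \<longrightarrow> projection_band_in E H)"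

end

theory Submission
  imports Defs
begin

text \<open>
  The point of the proof is that, for an ideal E of F, each of the three projection properties
  is a condition on the single elements of E, formulated in F alone. If such a condition defines
  an ideal R of F, then the ideals with the property are exactly the ideals contained in R.
  Since \<open>I\<^sub>h \<subseteq> R\<close> means \<open>h \<in> R\<close>, the set in question is R itself, and R has the property
  because \<open>R \<subseteq> R\<close> (\<open>ideal_of_generators\<close>).

  To find the conditions, consider the sum \<open>G\<^sup>d\<^sup>d + G\<^sup>d\<close>, formed in F. It is an ideal of F
  (\<open>ideal_in_polar_sum\<close>), and disjoint complements computed in E are the traces on E of those
  computed in F (\<open>disjoint_compl_Int_polar\<close>). So the trace of \<open>G\<^sup>d\<^sup>d\<close> on E is a projection band of E
  iff E lies in \<open>G\<^sup>d\<^sup>d + G\<^sup>d\<close>. It does not matter whether G consists of elements of E or of F: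
  to split x along G, it suffices to split x along the truncations \<open>\<bar>g\<bar> \<and> \<bar>x\<bar>\<close>
  (\<open>polar_sum_truncate\<close>), which do lie in E if x does. This settles PPP, with all singletons G.

  For PP and \<open>\<sigma>\<close>-PP, bands have to be compared with double complements. F need not be
  Archimedean, and then bands can be strictly smaller than their double complements. But the
  elements infinitely small relative to some \<open>x \<in> E\<close> form a band of E, and a band inside it
  that is a projection band cannot contain anything nonzero
  (\<open>archimedean_at_if_projection_bands\<close>). So PP and \<open>\<sigma>\<close>-PP force E to be Archimedean, and in
  Archimedean E every band is its double complement (\<open>band_eq_Int_polar_polar\<close>). The condition on
  x therefore is: x belongs to \<open>G\<^sup>d\<^sup>d + G\<^sup>d\<close> for all (for all countable) G, and no nonzero element
  is infinitely small relative to x.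

  It remains to see that these x form an ideal. The last clause is stable under
  addition thanks to the first (\<open>archimedean_at_add\<close>): split an element
  infinitely small relative to \<open>x + y\<close> into a part living where \<open>\<bar>y\<bar> \<le> \<bar>x\<bar>\<close> and a part living
  where \<open>\<bar>x\<bar> \<le> \<bar>y\<bar>\<close>; the first is infinitely small relative to x, the second relative to y.
\<close>

section \<open>Arithmetic in vector lattices\<close>

lemma abs_le_self_iff:
  fixes f x :: "'a::vector_lattice"
  shows "\<bar>f\<bar> \<le> x \<longleftrightarrow> f \<le> x \<and> - f \<le> x"
  by (simp add: abs_lattice)

lemma abs_scaleR_vector_lattice:
  fixes x :: "'a::vector_lattice"
  shows "\<bar>c *\<^sub>R x\<bar> = \<bar>c\<bar> *\<^sub>R \<bar>x\<bar>"
proof -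
  have le: "\<bar>c *\<^sub>R x\<bar> \<le> \<bar>c\<bar> *\<^sub>R \<bar>x\<bar>" for c and x :: 'a
  proof (cases "0 \<le> c")
    case True
    have "c *\<^sub>R x \<le> c *\<^sub>R \<bar>x\<bar>" "c *\<^sub>R (- x) \<le> c *\<^sub>R \<bar>x\<bar>"
      using True by (intro scaleR_left_mono; simp add: abs_ge_self abs_ge_minus_self)+
    with True show ?thesis by (simp add: abs_le_self_iff)
  next
    case False
    have "(- c) *\<^sub>R x \<le> (- c) *\<^sub>R \<bar>x\<bar>" "(- c) *\<^sub>R (- x) \<le> (- c) *\<^sub>R \<bar>x\<bar>"
      using False by (intro scaleR_left_mono; simp add: abs_ge_self abs_ge_minus_self)+
    with False show ?thesis by (simp add: abs_le_self_iff)
  qed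
  show ?thesis
  proof (cases "c = 0")
    case False
    have "\<bar>c\<bar> *\<^sub>R \<bar>inverse c *\<^sub>R (c *\<^sub>R x)\<bar> \<le> \<bar>c\<bar> *\<^sub>R (\<bar>inverse c\<bar> *\<^sub>R \<bar>c *\<^sub>R x\<bar>)"
      by (intro scaleR_left_mono le) simp
    with False have "\<bar>c\<bar> *\<^sub>R \<bar>x\<bar> \<le> \<bar>c *\<^sub>R x\<bar>"
      by (simp flip: abs_mult)
    with le[of c x] show ?thesis by (rule antisym)
  qed simp
qed

lemma inf_add_le:
  fixes x y z :: "'a::vector_lattice"
  assumes "0 \<le> x" "0 \<le> y" "0 \<le> z"
  shows "inf x (y + z) \<le> inf x y + inf x z"
proof -
  have "inf x (y + z) \<le> x + x" "inf x (y + z) \<le> x + z" "inf x (y + z) \<le> y + x"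
    using assms by (auto intro!: le_infI1 simp: add_increasing add_increasing2)
  then show ?thesis
    by (simp add: add_inf_distrib_left add_inf_distrib_right)
qed

lemma inf_abs_eq_0_mono:
  fixes x y x' y' :: "'a::vector_lattice"
  assumes "inf \<bar>x\<bar> \<bar>y\<bar> = 0" "\<bar>x'\<bar> \<le> \<bar>x\<bar>" "\<bar>y'\<bar> \<le> \<bar>y\<bar>"
  shows "inf \<bar>x'\<bar> \<bar>y'\<bar> = 0"
  using inf_mono[OF assms(2,3)] assms(1) by (intro antisym) auto

text \<open>A summand disjoint from x can be dropped from an upper bound of \<open>\<bar>x\<bar>\<close>: meet both sides with
  \<open>\<bar>x\<bar>\<close> and use subadditivity of the meet.\<close>
lemma le_add_disjointD:
  fixes x y z :: "'a::vector_lattice"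
  assumes "inf \<bar>x\<bar> \<bar>z\<bar> = 0" "\<bar>x\<bar> \<le> y + \<bar>z\<bar>" "0 \<le> y"
  shows "\<bar>x\<bar> \<le> y"
proof -
  have "\<bar>x\<bar> = inf \<bar>x\<bar> (y + \<bar>z\<bar>)"
    using assms(2) by (simp add: inf_absorb1)
  also have "\<dots> \<le> inf \<bar>x\<bar> y"
    using inf_add_le[of "\<bar>x\<bar>" y "\<bar>z\<bar>"] assms by simp
  also have "\<dots> \<le> y" by simp
  finally show ?thesis .
qed

lemma abs_le_abs_add_disjoint:
  fixes a b :: "'a::vector_lattice"
  assumes "inf \<bar>a\<bar> \<bar>b\<bar> = 0"
  shows "\<bar>a\<bar> \<le> \<bar>a + b\<bar>" "\<bar>b\<bar> \<le> \<bar>a + b\<bar>"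
proof -
  have *: "\<bar>a\<bar> \<le> \<bar>a + b\<bar>" if "inf \<bar>a\<bar> \<bar>b\<bar> = 0" for a b :: 'a
  proof (rule le_add_disjointD[OF that])
    show "\<bar>a\<bar> \<le> \<bar>a + b\<bar> + \<bar>b\<bar>"
      using abs_triangle_ineq[of "a + b" "- b"] by simp
  qed simp
  show "\<bar>a\<bar> \<le> \<bar>a + b\<bar>" using *[OF assms] .
  show "\<bar>b\<bar> \<le> \<bar>a + b\<bar>" using *[of b a] assms by (simp add: inf_commute add.commute)
qed

lemma riesz_decomposition:
  fixes f a b :: "'a::vector_lattice"
  assumes "\<bar>f\<bar> \<le> \<bar>a\<bar> + \<bar>b\<bar>"
  obtains f1 f2 where "f = f1 + f2" "\<bar>f1\<bar> \<le> \<bar>a\<bar>" "\<bar>f2\<bar> \<le> \<bar>b\<bar>"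
proof
  have f: "f \<le> \<bar>a\<bar> + \<bar>b\<bar>" "- f \<le> \<bar>a\<bar> + \<bar>b\<bar>"
    using assms by (simp_all add: abs_le_self_iff)
  \<comment> \<open>truncate f to the order interval between \<open>- \<bar>a\<bar>\<close> and \<open>\<bar>a\<bar>\<close>\<close>
  define f1 where "f1 = sup (- \<bar>a\<bar>) (inf f \<bar>a\<bar>)"
  have neg: "- \<bar>a\<bar> \<le> \<bar>a\<bar>" by (rule order_trans[of _ 0]) auto
  then have "f1 \<le> \<bar>a\<bar>" "- \<bar>a\<bar> \<le> f1" by (auto simp: f1_def)
  then show "\<bar>f1\<bar> \<le> \<bar>a\<bar>" using neg_le_iff_le[of f1 "- \<bar>a\<bar>"] by (simp add: abs_le_self_iff)
  show "f = f1 + (f - f1)" by simp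
  have "- \<bar>a\<bar> \<le> f + \<bar>b\<bar>"
    using add_mono[OF f(2) order_refl, of "f - \<bar>a\<bar>"] by (simp add: add.commute)
  moreover have "inf f \<bar>a\<bar> \<le> f + \<bar>b\<bar>"
    by (rule le_infI1) simp
  ultimately have "f1 - f \<le> \<bar>b\<bar>"
    by (simp add: f1_def diff_le_eq add.commute)
  moreover have "f - \<bar>b\<bar> \<le> inf f \<bar>a\<bar>"
    using f(1) by (simp add: diff_le_eq add.commute)
  then have "f - \<bar>b\<bar> \<le> f1"
    by (simp add: f1_def le_supI2)
  then have "f - f1 \<le> \<bar>b\<bar>"
    by (simp add: algebra_simps)
  ultimately show "\<bar>f - f1\<bar> \<le> \<bar>b\<bar>" by (simp add: abs_le_self_iff)
qed

section \<open>Ideals\<close>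

lemma ideal_inD:
  assumes "ideal_in E H"
  shows "subspace H" "H \<subseteq> E" "f \<in> E \<Longrightarrow> h \<in> H \<Longrightarrow> \<bar>f\<bar> \<le> \<bar>h\<bar> \<Longrightarrow> f \<in> H"
proof -
  have *: "subspace H" "H \<subseteq> E" "\<forall>f\<in>E. \<forall>h\<in>H. \<bar>f\<bar> \<le> \<bar>h\<bar> \<longrightarrow> f \<in> H"
    using assms unfolding ideal_in_def by - (elim conjE, assumption)+
  show "subspace H" "H \<subseteq> E" by (fact *)+
  show "f \<in> E \<Longrightarrow> h \<in> H \<Longrightarrow> \<bar>f\<bar> \<le> \<bar>h\<bar> \<Longrightarrow> f \<in> H"
    by (rule *(3)[rule_format])
qed

lemma ideal_in_UNIV_I:
  assumes "subspace H" "\<And>f h. h \<in> H \<Longrightarrow> \<bar>f\<bar> \<le> \<bar>h\<bar> \<Longrightarrow> f \<in> H"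
  shows "ideal_in UNIV H"
  using assms by (simp add: ideal_in_def)

lemma ideal_in_Int:
  assumes "ideal_in UNIV E" "ideal_in UNIV H"
  shows "ideal_in E (E \<inter> H)"
  unfolding ideal_in_def
proof (intro conjI ballI impI)
  show "subspace (E \<inter> H)" using assms[THEN ideal_inD(1)] by (rule subspace_inter)
  fix f h assume "f \<in> E" "h \<in> E \<inter> H" "\<bar>f\<bar> \<le> \<bar>h\<bar>"
  then show "f \<in> E \<inter> H" using ideal_inD(3)[OF assms(2), of f h] by simp
qed simp

lemma ideal_in_trans:
  assumes E: "ideal_in UNIV E" and H: "ideal_in E H"
  shows "ideal_in UNIV H"
proof (rule ideal_in_UNIV_I)
  show "subspace H" using H by (rule ideal_inD)
  fix f h assume h: "h \<in> H" and fh: "\<bar>f\<bar> \<le> \<bar>h\<bar>"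
  have "f \<in> E" using ideal_inD(3)[OF E UNIV_I _ fh] ideal_inD(2)[OF H] h by auto
  then show "f \<in> H" using h fh by (rule ideal_inD(3)[OF H])
qed

lemma ideal_in_sums:
  fixes A B :: "'a::vector_lattice set"
  assumes A: "ideal_in UNIV A" and B: "ideal_in UNIV B"
  shows "ideal_in UNIV {a + b | a b. a \<in> A \<and> b \<in> B}"
proof (rule ideal_in_UNIV_I)
  show "subspace {a + b | a b. a \<in> A \<and> b \<in> B}"
    using A B by (intro subspace_sums ideal_inD)
  fix f h assume "h \<in> {a + b | a b. a \<in> A \<and> b \<in> B}" and fh: "\<bar>f\<bar> \<le> \<bar>h\<bar>"
  then obtain a b where h: "h = a + b" "a \<in> A" "b \<in> B" by blast
  have "\<bar>f\<bar> \<le> \<bar>a\<bar> + \<bar>b\<bar>"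
    using fh abs_triangle_ineq[of a b] unfolding h(1) by (rule order_trans)
  then obtain f1 f2 where f: "f = f1 + f2" "\<bar>f1\<bar> \<le> \<bar>a\<bar>" "\<bar>f2\<bar> \<le> \<bar>b\<bar>"
    by (rule riesz_decomposition)
  have "f1 \<in> A" "f2 \<in> B"
    using ideal_inD(3)[OF A UNIV_I h(2) f(2)] ideal_inD(3)[OF B UNIV_I h(3) f(3)] .
  with f(1) show "f \<in> {a + b | a b. a \<in> A \<and> b \<in> B}" by blast
qed

lemma ideal_in_principal_ideal:
  fixes h :: "'a::vector_lattice"
  shows "ideal_in UNIV (principal_ideal h)"
  unfolding principal_ideal_def
proof (rule hull_in)
  fix T :: "'a set set" assume T: "\<forall>H\<in>T. ideal_in UNIV H"
  show "ideal_in UNIV (\<Inter>T)"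
  proof (rule ideal_in_UNIV_I)
    show "subspace (\<Inter>T)" using T by (intro subspace_Inter ballI ideal_inD(1)) (rule bspec)
    fix f h assume "h \<in> \<Inter>T" and fh: "\<bar>f\<bar> \<le> \<bar>h\<bar>"
    then show "f \<in> \<Inter>T" using ideal_inD(3)[OF bspec[OF T] UNIV_I _ fh] by simp
  qed
qed

lemma principal_ideal_subset_iff:
  assumes "ideal_in UNIV H"
  shows "principal_ideal h \<subseteq> H \<longleftrightarrow> h \<in> H"
  using subset_hull[of "ideal_in UNIV" H "{h}"] assms by (simp add: principal_ideal_def)

section \<open>Disjoint complements and splitting\<close>

text \<open>The complement \<open>G\<^sup>d\<close> in the ambient lattice F; complements in an ideal E are traces of it.\<close>
abbreviation polar :: "'a::vector_lattice set \<Rightarrow> 'a set" where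
  "polar G \<equiv> disjoint_compl UNIV G"

lemma polar_iff: "f \<in> polar G \<longleftrightarrow> (\<forall>g\<in>G. inf \<bar>f\<bar> \<bar>g\<bar> = 0)"
  by (simp add: disjoint_compl_def)

lemma polarD: "f \<in> polar G \<Longrightarrow> g \<in> G \<Longrightarrow> inf \<bar>f\<bar> \<bar>g\<bar> = 0"
  by (simp add: polar_iff)

lemma polar_antimono: "G \<subseteq> H \<Longrightarrow> polar H \<subseteq> polar G"
proof
  fix f assume GH: "G \<subseteq> H" and f: "f \<in> polar H"
  show "f \<in> polar G"
    unfolding polar_iff
  proof
    fix g assume "g \<in> G"
    with GH have "g \<in> H" by (rule subsetD)
    with f show "inf \<bar>f\<bar> \<bar>g\<bar> = 0" by (rule polarD)
  qed
qed

lemma subset_polar_polar: "G \<subseteq> polar (polar G)"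
proof
  fix g assume g: "g \<in> G"
  show "g \<in> polar (polar G)"
    unfolding polar_iff[of g]
  proof
    fix f assume "f \<in> polar G"
    then have "inf \<bar>f\<bar> \<bar>g\<bar> = 0" using g by (rule polarD)
    then show "inf \<bar>g\<bar> \<bar>f\<bar> = 0" by (simp only: inf.commute)
  qed
qed

lemma polar_polar_polar: "polar (polar (polar G)) = polar G"
proof (rule antisym)
  show "polar (polar (polar G)) \<subseteq> polar G" by (rule polar_antimono[OF subset_polar_polar])
qed (rule subset_polar_polar)

lemma ideal_in_polar:
  fixes G :: "'a::vector_lattice set"
  shows "ideal_in UNIV (polar G)"
proof (rule ideal_in_UNIV_I)
  have add: "x + y \<in> polar G" if x: "x \<in> polar G" and y: "y \<in> polar G" for x y
    unfolding polar_iff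
  proof
    fix g assume g: "g \<in> G"
    have "inf \<bar>g\<bar> \<bar>x + y\<bar> \<le> inf \<bar>g\<bar> (\<bar>x\<bar> + \<bar>y\<bar>)"
      by (intro inf_mono abs_triangle_ineq order_refl)
    also have "\<dots> \<le> inf \<bar>g\<bar> \<bar>x\<bar> + inf \<bar>g\<bar> \<bar>y\<bar>"
      by (intro inf_add_le) auto
    also have "\<dots> = 0"
      using polarD[OF x g] polarD[OF y g] by (simp add: inf.commute)
    finally have "inf \<bar>x + y\<bar> \<bar>g\<bar> \<le> 0" by (simp only: inf.commute)
    then show "inf \<bar>x + y\<bar> \<bar>g\<bar> = 0" by (intro antisym) simp_all
  qed
  have solid: "f \<in> polar G" if "h \<in> polar G" "\<bar>f\<bar> \<le> \<bar>h\<bar>" for f h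
    unfolding polar_iff
  proof
    fix g assume "g \<in> G"
    with that(1) have "inf \<bar>h\<bar> \<bar>g\<bar> = 0" by (rule polarD)
    then show "inf \<bar>f\<bar> \<bar>g\<bar> = 0" using that(2) order_refl by (rule inf_abs_eq_0_mono)
  qed
  have zero: "0 \<in> polar G" by (simp add: polar_iff inf_absorb1)
  show "subspace (polar G)"
  proof (rule subspaceI[OF zero add])
    fix c x assume x: "x \<in> polar G"
    \<comment> \<open>multiples by natural numbers come from sums, all others from solidity\<close>
    obtain n where n: "\<bar>c\<bar> \<le> real n" using real_arch_simple by blast
    have nx: "real n *\<^sub>R x \<in> polar G"
      by (induction n) (auto simp: zero scaleR_add_left intro: add x)
    have "\<bar>c *\<^sub>R x\<bar> \<le> \<bar>real n *\<^sub>R x\<bar>"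
      using n by (simp add: abs_scaleR_vector_lattice scaleR_right_mono)
    with nx show "c *\<^sub>R x \<in> polar G" by (rule solid)
  qed
  show "f \<in> polar G" if "h \<in> polar G" "\<bar>f\<bar> \<le> \<bar>h\<bar>" for f h
    using that by (rule solid)
qed

lemma disjoint_compl_eq: "disjoint_compl E G = E \<inter> polar G"
  by (auto simp: disjoint_compl_def)

text \<open>An element a of E disjoint from the part of \<open>G\<^sup>d\<close> inside E is disjoint from all of \<open>G\<^sup>d\<close>, because
  for y in \<open>G\<^sup>d\<close> the element \<open>\<bar>a\<bar> \<and> \<bar>y\<bar>\<close> lies in both E and \<open>G\<^sup>d\<close>, so it is disjoint from a and hence
  zero. Thus iterated complements can be taken in F instead of E.\<close>

lemma disjoint_compl_Int_polar:
  fixes E :: "'a::vector_lattice set"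
  assumes E: "ideal_in UNIV E"
  shows "disjoint_compl E (E \<inter> polar G) = E \<inter> polar (polar G)"
proof -
  have "polar (E \<inter> polar G) \<inter> E \<subseteq> polar (polar G)"
  proof (rule subsetI, elim IntE)
    fix a assume a: "a \<in> polar (E \<inter> polar G)" "a \<in> E"
    show "a \<in> polar (polar G)"
      unfolding polar_iff[of a]
    proof
      fix y assume y: "y \<in> polar G"
      let ?z = "inf \<bar>a\<bar> \<bar>y\<bar>"
      have z: "\<bar>?z\<bar> = ?z" by simp
      have "?z \<in> E" by (rule ideal_inD(3)[OF E UNIV_I a(2)]) (simp add: z)
      moreover have "?z \<in> polar G" by (rule ideal_inD(3)[OF ideal_in_polar UNIV_I y]) (simp add: z)
      ultimately have "inf \<bar>a\<bar> \<bar>?z\<bar> = 0" by (intro polarD[OF a(1)] IntI)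
      then show "?z = 0" unfolding z by simp
    qed
  qed
  moreover have "polar (polar G) \<subseteq> polar (E \<inter> polar G)"
    by (rule polar_antimono) simp
  ultimately show ?thesis unfolding disjoint_compl_eq[of E] by blast
qed

definition polar_sum :: "'a::vector_lattice set \<Rightarrow> 'a set" where
  "polar_sum G = {a + b | a b. a \<in> polar (polar G) \<and> b \<in> polar G}"

lemma ideal_in_polar_sum: "ideal_in UNIV (polar_sum G)"
  unfolding polar_sum_def by (intro ideal_in_sums ideal_in_polar)

text \<open>The components of x are disjoint and thus dominated by x, so they stay in every ideal
  that contains x.\<close>
lemma polar_sumE:
  assumes "x \<in> polar_sum G"
  obtains a b where "x = a + b" "a \<in> polar (polar G)" "b \<in> polar G" "\<bar>a\<bar> \<le> \<bar>x\<bar>" "\<bar>b\<bar> \<le> \<bar>x\<bar>"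
proof -
  from assms obtain a b where ab: "x = a + b" "a \<in> polar (polar G)" "b \<in> polar G"
    unfolding polar_sum_def by blast
  have "inf \<bar>a\<bar> \<bar>b\<bar> = 0" using ab(2,3) by (rule polarD)
  from abs_le_abs_add_disjoint[OF this] show thesis using that[OF ab] ab(1) by simp
qed

text \<open>Replaces a condition internal to E by inclusion in an ideal of F that does not depend on E.\<close>
lemma projection_band_in_polar_polar_iff:
  fixes E :: "'a::vector_lattice set"
  assumes E: "ideal_in UNIV E"
  shows "projection_band_in E (E \<inter> polar (polar G)) \<longleftrightarrow> E \<subseteq> polar_sum G"
proof -
  have compl: "disjoint_compl E (E \<inter> polar (polar G)) = E \<inter> polar G"
    using disjoint_compl_Int_polar[OF E, of "polar G"] by (simp add: polar_polar_polar)
  have "{a + b | a b. a \<in> E \<inter> polar (polar G) \<and> b \<in> E \<inter> polar G} = E \<inter> polar_sum G"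
  proof (intro equalityI subsetI)
    fix x assume "x \<in> {a + b | a b. a \<in> E \<inter> polar (polar G) \<and> b \<in> E \<inter> polar G}"
    then show "x \<in> E \<inter> polar_sum G"
      using subspace_add[OF ideal_inD(1)[OF E]] unfolding polar_sum_def by blast
  next
    fix x assume x: "x \<in> E \<inter> polar_sum G"
    then have "x \<in> polar_sum G" by simp
    then obtain a b where ab: "x = a + b" "a \<in> polar (polar G)" "b \<in> polar G"
        "\<bar>a\<bar> \<le> \<bar>x\<bar>" "\<bar>b\<bar> \<le> \<bar>x\<bar>"
      by (rule polar_sumE)
    have "x \<in> E" using x by simp
    then have "a \<in> E" "b \<in> E"
      using ideal_inD(3)[OF E UNIV_I _ ab(4)] ideal_inD(3)[OF E UNIV_I _ ab(5)] by simp_all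
    with ab show "x \<in> {a + b | a b. a \<in> E \<inter> polar (polar G) \<and> b \<in> E \<inter> polar G}" by blast
  qed
  then show ?thesis
    using ideal_in_Int[OF E ideal_in_polar]
    by (simp only: projection_band_in_def compl) (metis Int_lower1 Int_lower2 inf.orderE)
qed

text \<open>Passing to the truncations enlarges \<open>G\<^sup>d\<close> and so shrinks \<open>G\<^sup>d\<^sup>d\<close>. The component in the enlarged
  complement still is disjoint from G, as it is dominated by x and does not notice the truncation
  at \<open>\<bar>x\<bar>\<close>. This is how a condition on subsets of E becomes one on subsets of F.\<close>
lemma polar_sum_truncate:
  assumes "x \<in> polar_sum ((\<lambda>e. inf \<bar>e\<bar> \<bar>x\<bar>) ` G)"
  shows "x \<in> polar_sum G"
proof -
  let ?T = "(\<lambda>e. inf \<bar>e\<bar> \<bar>x\<bar>) ` G"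
  from assms obtain a b where ab: "x = a + b" "a \<in> polar (polar ?T)" "b \<in> polar ?T" "\<bar>b\<bar> \<le> \<bar>x\<bar>"
    by (rule polar_sumE)
  have "polar G \<subseteq> polar ?T"
  proof
    fix y assume y: "y \<in> polar G"
    show "y \<in> polar ?T"
      unfolding polar_iff
    proof safe
      fix e assume "e \<in> G"
      with y have "inf \<bar>y\<bar> \<bar>e\<bar> = 0" by (rule polarD)
      then show "inf \<bar>y\<bar> \<bar>inf \<bar>e\<bar> \<bar>x\<bar>\<bar> = 0"
        by (rule inf_abs_eq_0_mono) auto
    qed
  qed
  then have "a \<in> polar (polar G)" using ab(2) by (rule subsetD[OF polar_antimono])
  moreover have "b \<in> polar G"
    unfolding polar_iff
  proof
    fix e assume "e \<in> G"
    then have "inf \<bar>b\<bar> \<bar>inf \<bar>e\<bar> \<bar>x\<bar>\<bar> = 0" by (intro polarD[OF ab(3)] imageI)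
    moreover have "inf \<bar>b\<bar> \<bar>inf \<bar>e\<bar> \<bar>x\<bar>\<bar> = inf \<bar>b\<bar> \<bar>e\<bar>"
      using inf.left_commute[of "\<bar>b\<bar>" "\<bar>e\<bar>" "\<bar>x\<bar>"] inf_absorb1[OF ab(4)]
        inf.commute[of "\<bar>b\<bar>" "\<bar>e\<bar>"] by simp
    ultimately show "inf \<bar>b\<bar> \<bar>e\<bar> = 0" by simp
  qed
  ultimately show ?thesis unfolding polar_sum_def using ab(1) by blast
qed

section \<open>Infinitesimals\<close>

text \<open>Negative factors t are included, so e and \<open>- e\<close> are treated alike and no sign condition on e
  is required.\<close>
definition infinitesimals :: "'a::vector_lattice \<Rightarrow> 'a set" where
  "infinitesimals x = {e. \<forall>t. t *\<^sub>R e \<le> \<bar>x\<bar>}"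

lemma abs_scaleR_infinitesimal_le:
  assumes "e \<in> infinitesimals x"
  shows "t *\<^sub>R \<bar>e\<bar> \<le> \<bar>x\<bar>"
proof -
  have "t *\<^sub>R \<bar>e\<bar> \<le> \<bar>t\<bar> *\<^sub>R \<bar>e\<bar>" by (rule scaleR_right_mono) auto
  also have "\<dots> = \<bar>t *\<^sub>R e\<bar>" by (rule abs_scaleR_vector_lattice[symmetric])
  also have "\<dots> \<le> \<bar>x\<bar>"
    using assms unfolding infinitesimals_def abs_le_self_iff
    by (metis mem_Collect_eq scaleR_minus_left)
  finally show ?thesis .
qed

lemma ideal_in_infinitesimals:
  fixes x :: "'a::vector_lattice"
  shows "ideal_in UNIV (infinitesimals x)"
proof (rule ideal_in_UNIV_I)
  show "subspace (infinitesimals x)"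
  proof (rule subspaceI)
    fix e f assume e: "e \<in> infinitesimals x" and f: "f \<in> infinitesimals x"
    have "t *\<^sub>R (e + f) \<le> \<bar>x\<bar>" for t
    proof -
      have "(2 * t) *\<^sub>R e + (2 * t) *\<^sub>R f \<le> \<bar>x\<bar> + \<bar>x\<bar>"
        using e f by (intro add_mono) (auto simp: infinitesimals_def)
      then have "2 *\<^sub>R (t *\<^sub>R (e + f)) \<le> 2 *\<^sub>R \<bar>x\<bar>"
        by (simp add: scaleR_add_right scaleR_2)
      then show ?thesis by (subst (asm) pos_le_divideR_eq[symmetric]) auto
    qed
    then show "e + f \<in> infinitesimals x" by (simp add: infinitesimals_def)
  qed (auto simp: infinitesimals_def)
  fix f h assume h: "h \<in> infinitesimals x" and le: "\<bar>f\<bar> \<le> \<bar>h\<bar>"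
  have "t *\<^sub>R f \<le> \<bar>x\<bar>" for t
  proof -
    have "t *\<^sub>R f \<le> \<bar>t *\<^sub>R f\<bar>" by (rule abs_ge_self)
    also have "\<dots> = \<bar>t\<bar> *\<^sub>R \<bar>f\<bar>" by (rule abs_scaleR_vector_lattice)
    also have "\<dots> \<le> \<bar>t\<bar> *\<^sub>R \<bar>h\<bar>" using le by (intro scaleR_left_mono) auto
    also have "\<dots> \<le> \<bar>x\<bar>" using h by (rule abs_scaleR_infinitesimal_le)
    finally show ?thesis .
  qed
  then show "f \<in> infinitesimals x" by (simp add: infinitesimals_def)
qed

lemma infinitesimals_scaleR_subset:
  assumes "c > 0" "\<bar>y\<bar> \<le> c *\<^sub>R \<bar>x\<bar>"
  shows "infinitesimals y \<subseteq> infinitesimals x"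
proof
  fix e assume e: "e \<in> infinitesimals y"
  have "t *\<^sub>R e \<le> \<bar>x\<bar>" for t
  proof -
    have "(c * t) *\<^sub>R e \<le> \<bar>y\<bar>" using e by (simp add: infinitesimals_def)
    with assms have "c *\<^sub>R (t *\<^sub>R e) \<le> c *\<^sub>R \<bar>x\<bar>" by simp
    with assms(1) show ?thesis by (subst (asm) pos_le_divideR_eq[symmetric]) auto
  qed
  then show "e \<in> infinitesimals x" by (simp add: infinitesimals_def)
qed

text \<open>E is Archimedean iff this holds at every x in E; the pointwise version lets the Archimedean
  property be combined with other conditions on x.\<close>
definition archimedean_at :: "'a::vector_lattice \<Rightarrow> bool" where
  "archimedean_at x \<longleftrightarrow> infinitesimals x \<subseteq> {0}"

text \<open>On the part where e lives, y is dominated by x: we have \<open>\<bar>x + y\<bar> \<le> 2 \<bar>x\<bar> + (\<bar>y\<bar> - \<bar>x\<bar>)\<^sup>+\<close>, and the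
  last term is disjoint from all multiples of e.\<close>
lemma infinitesimals_disjoint:
  assumes e: "e \<in> infinitesimals (x + y)" and perp: "inf \<bar>e\<bar> \<bar>pprt (\<bar>y\<bar> - \<bar>x\<bar>)\<bar> = 0"
  shows "e \<in> infinitesimals x"
proof -
  have "(2 * t) *\<^sub>R e \<le> 2 *\<^sub>R \<bar>x\<bar>" for t
  proof -
    let ?d = "pprt (\<bar>y\<bar> - \<bar>x\<bar>)" and ?f = "(2 * t) *\<^sub>R e"
    have "e \<in> polar {?d}" using perp by (simp add: polar_iff)
    then have "?f \<in> polar {?d}"
      by (rule subspace_scale[OF ideal_inD(1)[OF ideal_in_polar]])
    then have "inf \<bar>?f\<bar> \<bar>?d\<bar> = 0" by (simp add: polar_iff)
    moreover have "\<bar>?f\<bar> \<le> 2 *\<^sub>R \<bar>x\<bar> + \<bar>?d\<bar>"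
    proof -
      have "\<bar>?f\<bar> \<le> \<bar>x + y\<bar>"
        using abs_scaleR_infinitesimal_le[OF e] by (simp only: abs_scaleR_vector_lattice)
      also have "\<dots> \<le> \<bar>x\<bar> + \<bar>y\<bar>" by (rule abs_triangle_ineq)
      also have "\<dots> = 2 *\<^sub>R \<bar>x\<bar> + (\<bar>y\<bar> - \<bar>x\<bar>)" by (simp add: scaleR_2)
      also have "\<dots> \<le> 2 *\<^sub>R \<bar>x\<bar> + \<bar>?d\<bar>"
        by (intro add_left_mono) (simp add: pprt_def)
      finally show ?thesis .
    qed
    ultimately have "\<bar>?f\<bar> \<le> 2 *\<^sub>R \<bar>x\<bar>"
      by (rule le_add_disjointD) (simp add: scaleR_2)
    then show ?thesis by (rule order_trans[OF abs_ge_self])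
  qed
  then have "2 *\<^sub>R (t *\<^sub>R e) \<le> 2 *\<^sub>R \<bar>x\<bar>" for t by (simp only: scaleR_scaleR)
  then have "t *\<^sub>R e \<le> \<bar>x\<bar>" for t
    by (subst (asm) pos_le_divideR_eq[symmetric]) auto
  then show ?thesis by (simp add: infinitesimals_def)
qed

text \<open>The two components of an infinitesimal with respect to \<open>(\<bar>x\<bar> - \<bar>y\<bar>)\<^sup>+\<close> are infinitesimal relative
  to x and to y respectively: one is disjoint from \<open>(\<bar>y\<bar> - \<bar>x\<bar>)\<^sup>+\<close>, the other from \<open>(\<bar>x\<bar> - \<bar>y\<bar>)\<^sup>+\<close>.\<close>
lemma archimedean_at_add:
  fixes x y :: "'a::vector_lattice"
  assumes x: "archimedean_at x" and y: "archimedean_at y"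
    and split: "x + y \<in> polar_sum {pprt (\<bar>x\<bar> - \<bar>y\<bar>)}"
  shows "archimedean_at (x + y)"
  unfolding archimedean_at_def
proof
  let ?d = "pprt (\<bar>x\<bar> - \<bar>y\<bar>)" and ?d' = "pprt (\<bar>y\<bar> - \<bar>x\<bar>)"
  fix e assume e: "e \<in> infinitesimals (x + y)"
  then have "\<bar>e\<bar> \<le> \<bar>x + y\<bar>" using abs_scaleR_infinitesimal_le[of e _ 1] by simp
  then have "e \<in> polar_sum {?d}" using ideal_inD(3)[OF ideal_in_polar_sum _ split] by simp
  then obtain a b where ab: "e = a + b" "a \<in> polar (polar {?d})" "b \<in> polar {?d}"
      "\<bar>a\<bar> \<le> \<bar>e\<bar>" "\<bar>b\<bar> \<le> \<bar>e\<bar>"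
    by (rule polar_sumE)
  then have inf: "a \<in> infinitesimals (x + y)" "b \<in> infinitesimals (y + x)"
    using ideal_inD(3)[OF ideal_in_infinitesimals _ e] by (auto simp: add.commute)
  have "inf ?d' ?d = 0"
  proof -
    have "?d' = - nprt (\<bar>x\<bar> - \<bar>y\<bar>)"
      using pprt_neg[of "\<bar>x\<bar> - \<bar>y\<bar>"] by simp
    moreover have "inf (- nprt c) (pprt c) = 0" for c :: 'a
    proof -
      have "inf (- nprt c) (pprt c) = inf 0 (pprt c + nprt c) - nprt c"
        using add_inf_distrib_right[of 0 "pprt c + nprt c" "- nprt c"] by simp
      also have "\<dots> = 0"
        unfolding prts[symmetric] by (simp only: nprt_def inf_commute diff_self)
      finally show ?thesis .
    qed
    ultimately show ?thesis by simp
  qed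
  then have "?d' \<in> polar {?d}" by (simp add: polar_iff)
  with ab(2) have "inf \<bar>a\<bar> \<bar>?d'\<bar> = 0" by (rule polarD)
  with inf(1) have "a \<in> infinitesimals x" by (rule infinitesimals_disjoint)
  moreover have "inf \<bar>b\<bar> \<bar>?d\<bar> = 0" using ab(3) by (simp add: polar_iff)
  with inf(2) have "b \<in> infinitesimals y" by (rule infinitesimals_disjoint)
  ultimately have "a = 0" "b = 0" using x y unfolding archimedean_at_def by blast+
  with ab(1) show "e \<in> {0}" by simp
qed

section \<open>Bands\<close>

text \<open>Only nonempty sets have to be considered: a supremum of the empty set is a least element of
  E, which exists only if E is zero.\<close>
lemma band_inI:
  fixes E :: "'a::vector_lattice set"
  assumes E: "ideal_in UNIV E" and H: "ideal_in E H"
    and sup: "\<And>A s a. A \<subseteq> H \<Longrightarrow> a \<in> A \<Longrightarrow> isLub E A s \<Longrightarrow> s \<in> H"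
  shows "band_in E H"
  unfolding band_in_def
proof (intro conjI allI impI H)
  fix A s assume A: "A \<subseteq> H" and s: "isLub E A s"
  show "s \<in> H"
  proof (cases "A = {}")
    case True
    have least: "s \<le> y" if "y \<in> E" for y
      using s that True by (intro isLub_le_isUb[OF s]) (simp add: isUb_def setle_def)
    have sE: "s \<in> E" using s by (rule isLubD1a)
    note E0 = ideal_inD(1)[OF E]
    have "s \<le> 0" "s \<le> s + s"
      using least[OF subspace_0[OF E0]] least[OF subspace_add[OF E0 sE sE]] .
    then have "s = 0" by simp
    then show ?thesis using subspace_0[OF ideal_inD(1)[OF H]] by simp
  qed (use sup A s in blast)
qed

lemma band_inD:
  assumes "band_in E H"
  shows "ideal_in E H" "A \<subseteq> H \<Longrightarrow> isLub E A s \<Longrightarrow> s \<in> H"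
  using assms unfolding band_in_def by blast+

text \<open>The general fact on hulls does not apply, since the intersection of the empty family need not be
  a band of E; here E itself is a member of the family.\<close>
lemma band_in_hull:
  assumes E: "ideal_in UNIV E" and C: "C \<subseteq> E"
  shows "band_in E (band_in E hull C)"
proof -
  have EE: "ideal_in E E" using E by (auto simp: ideal_in_def)
  have "band_in E E" by (rule band_inI[OF E EE]) (rule isLubD1a)
  then have "band_in E hull C \<subseteq> E" using C by (rule hull_minimal[rotated])
  moreover have "subspace (band_in E hull C)"
    unfolding hull_def by (rule subspace_Inter) (auto dest: band_inD(1) ideal_inD(1))
  moreover have "f \<in> band_in E hull C"
    if f: "f \<in> E" and h: "h \<in> band_in E hull C" and le: "\<bar>f\<bar> \<le> \<bar>h\<bar>" for f h
    unfolding hull_def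
  proof (rule InterI)
    fix T assume T: "T \<in> {T. band_in E T \<and> C \<subseteq> T}"
    then have "ideal_in E T" by (auto dest: band_inD(1))
    moreover have "h \<in> T" using h T unfolding hull_def by (rule InterD)
    ultimately show "f \<in> T" using f le by (auto dest: ideal_inD(3))
  qed
  ultimately have ideal: "ideal_in E (band_in E hull C)" by (simp add: ideal_in_def)
  show ?thesis
  proof (rule band_inI[OF E ideal])
    fix A s assume A: "A \<subseteq> band_in E hull C" and s: "isLub E A s"
    show "s \<in> band_in E hull C"
      unfolding hull_def
    proof (rule InterI)
      fix T assume T: "T \<in> {T. band_in E T \<and> C \<subseteq> T}"
      then have "A \<subseteq> T" using A hull_minimal[of C T] by auto
      with T s show "s \<in> T" by (auto intro: band_inD(2))
    qed
  qed
qed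

text \<open>Let s be the supremum of A and let \<open>a\<^sub>0 \<in> A\<close>. The part w of \<open>s - a\<^sub>0\<close> below \<open>\<bar>g\<bar>\<close> is disjoint
  from all \<open>(a - a\<^sub>0)\<^sup>+\<close>, so both fit side by side below \<open>s - a\<^sub>0\<close>. Then \<open>s - w\<close> still bounds A, and
  w vanishes.\<close>
lemma band_in_Int_polar:
  fixes E :: "'a::vector_lattice set"
  assumes E: "ideal_in UNIV E"
  shows "band_in E (E \<inter> polar G)"
proof (rule band_inI[OF E ideal_in_Int[OF E ideal_in_polar]])
  fix A s a0 assume A: "A \<subseteq> E \<inter> polar G" and a0: "a0 \<in> A" and s: "isLub E A s"
  have sE: "s \<in> E" using s by (rule isLubD1a)
  note E0 = ideal_inD(1)[OF E] and P0 = ideal_inD(1)[OF ideal_in_polar[of G]]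
  have ge: "0 \<le> s - a0" using isLubD2[OF s a0] by simp
  have "s - a0 \<in> polar G"
    unfolding polar_iff
  proof
    fix g assume g: "g \<in> G"
    define w where "w = inf \<bar>s - a0\<bar> \<bar>g\<bar>"
    have w0: "0 \<le> w" by (simp add: w_def)
    have "w \<in> E"
      using ideal_inD(3)[OF E, of w "s - a0"] subspace_diff[OF E0 sE] A a0 w0
      by (auto simp: w_def)
    have "a \<le> s - w" if a: "a \<in> A" for a
    proof -
      let ?b = "pprt (a - a0)"
      have "a - a0 \<in> polar G" using A a a0 by (intro subspace_diff[OF P0]) auto
      then have "inf \<bar>a - a0\<bar> \<bar>g\<bar> = 0" using g by (simp add: polar_iff)
      then have "inf \<bar>?b\<bar> \<bar>w\<bar> = 0"
        by (rule inf_abs_eq_0_mono) (auto simp: w_def pprt_def abs_ge_self)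
      then have "?b + w = sup ?b w"
        using add_eq_inf_sup[of ?b w] w0 by simp
      also have "\<dots> \<le> s - a0"
        using ge isLubD2[OF s a] by (auto simp: pprt_def w_def le_infI1)
      finally have "?b + w \<le> s - a0" .
      moreover have "a - a0 \<le> ?b" by (simp add: pprt_def)
      ultimately have "a - a0 + w \<le> s - a0" by (meson add_right_mono order_trans)
      then show ?thesis by (simp add: algebra_simps)
    qed
    then have "s \<le> s - w"
      using subspace_diff[OF E0 sE \<open>w \<in> E\<close>]
      by (intro isLub_le_isUb[OF s]) (simp add: isUb_def setle_def)
    then have "w \<le> 0" by simp
    with w0 show "inf \<bar>s - a0\<bar> \<bar>g\<bar> = 0" unfolding w_def by (rule antisym[rotated])
  qed
  then have "(s - a0) + a0 \<in> polar G" using A a0 by (intro subspace_add[OF P0]) auto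
  with sE show "s \<in> E \<inter> polar G" by simp
qed

text \<open>For positive t, the bound \<open>\<bar>x\<bar> / t\<close> is common to all infinitesimals and belongs to E, so it
  passes to suprema in E; for the other t one member of the set suffices.\<close>
lemma band_in_infinitesimals:
  fixes E :: "'a::vector_lattice set"
  assumes E: "ideal_in UNIV E" and x: "x \<in> E"
  shows "band_in E (E \<inter> infinitesimals x)"
proof (rule band_inI[OF E ideal_in_Int[OF E ideal_in_infinitesimals]])
  fix A s a0 assume A: "A \<subseteq> E \<inter> infinitesimals x" and a0: "a0 \<in> A" and s: "isLub E A s"
  have "t *\<^sub>R s \<le> \<bar>x\<bar>" for t
  proof (cases "t > 0")
    case True
    have "\<bar>x\<bar> \<in> E" using ideal_inD(3)[OF E _ x] by simp
    then have "\<bar>x\<bar> /\<^sub>R t \<in> E" by (rule subspace_scale[OF ideal_inD(1)[OF E]])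
    moreover have "a \<le> \<bar>x\<bar> /\<^sub>R t" if "a \<in> A" for a
      using A that True by (auto simp: pos_le_divideR_eq infinitesimals_def)
    ultimately have "s \<le> \<bar>x\<bar> /\<^sub>R t"
      by (intro isLub_le_isUb[OF s]) (simp add: isUb_def setle_def)
    with True show ?thesis by (simp add: pos_le_divideR_eq)
  next
    case False
    then have "(- t) *\<^sub>R a0 \<le> (- t) *\<^sub>R s"
      using isLubD2[OF s a0] by (intro scaleR_left_mono) auto
    then have "t *\<^sub>R s \<le> t *\<^sub>R a0" by simp
    also have "\<dots> \<le> \<bar>x\<bar>" using A a0 by (auto simp: infinitesimals_def)
    finally show ?thesis .
  qed
  with isLubD1a[OF s] show "s \<in> E \<inter> infinitesimals x" by (simp add: infinitesimals_def)
qed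

text \<open>Let e be infinitesimal relative to x, and let \<open>x = a + b\<close> be the decomposition along the band
  generated by e. This band consists of infinitesimals, so \<open>2 \<bar>a\<bar> \<le> \<bar>x\<bar> \<le> \<bar>a\<bar> + \<bar>b\<bar>\<close>, and \<open>a = 0\<close> by
  disjointness. Then x equals b and is disjoint from e although it dominates e.\<close>
lemma archimedean_at_if_projection_bands:
  fixes E :: "'a::vector_lattice set"
  assumes E: "ideal_in UNIV E" and x: "x \<in> E"
    and proj: "\<And>e. e \<in> E \<Longrightarrow> projection_band_in E (band_in E hull {e})"
  shows "archimedean_at x"
  unfolding archimedean_at_def
proof
  fix e assume e: "e \<in> infinitesimals x"
  have ex: "\<bar>e\<bar> \<le> \<bar>x\<bar>" using abs_scaleR_infinitesimal_le[OF e, of 1] by simp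
  then have eE: "e \<in> E" using ideal_inD(3)[OF E _ x] by simp
  let ?B = "band_in E hull {e}"
  have "?B \<subseteq> E \<inter> infinitesimals x"
    using e eE by (intro hull_minimal band_in_infinitesimals E x) auto
  moreover obtain a b where ab: "x = a + b" "a \<in> ?B" "b \<in> disjoint_compl E ?B"
    using proj[OF eE] x unfolding projection_band_in_def by blast
  ultimately have a: "a \<in> infinitesimals x" by blast
  have perp: "inf \<bar>b\<bar> \<bar>a\<bar> = 0" "inf \<bar>b\<bar> \<bar>e\<bar> = 0"
    using ab hull_inc[of e "{e}" "band_in E"] by (auto simp: disjoint_compl_def)
  have "\<bar>a\<bar> + \<bar>a\<bar> \<le> \<bar>a + b\<bar>"
    using abs_scaleR_infinitesimal_le[OF a, of 2] ab(1) by (simp add: scaleR_2)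
  also have "\<dots> \<le> \<bar>a\<bar> + \<bar>b\<bar>" by (rule abs_triangle_ineq)
  finally have "\<bar>a\<bar> \<le> \<bar>b\<bar>" by simp
  with perp(1) have "a = 0" by (simp add: inf_absorb2)
  with ab(1) ex have "\<bar>e\<bar> \<le> \<bar>b\<bar>" by simp
  with perp(2) show "e \<in> {0}" by (simp add: inf_absorb2)
qed

lemma infinitesimalI_of_nat:
  fixes z a :: "'a::vector_lattice"
  assumes z: "0 \<le> z" and le: "\<And>n. real n *\<^sub>R z \<le> a"
  shows "z \<in> infinitesimals a"
proof -
  have "t *\<^sub>R z \<le> \<bar>a\<bar>" for t
  proof -
    obtain n where "t \<le> real n" using real_arch_simple by blast
    then have "t *\<^sub>R z \<le> real n *\<^sub>R z" using z by (rule scaleR_right_mono)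
    also have "\<dots> \<le> a" by (rule le)
    also have "\<dots> \<le> \<bar>a\<bar>" by (rule abs_ge_self)
    finally show ?thesis .
  qed
  then show ?thesis by (simp add: infinitesimals_def)
qed

text \<open>A positive element a of the double complement is the supremum of the elements of H below it.
  Otherwise some upper bound leaves a gap d below a; d lies in \<open>H\<^sup>d\<^sup>d\<close>, hence dominates some
  nonzero positive z in H. If n z is below a, it is below the bound, and adding z, which fits
  into the gap, gives \<open>(n + 1) z \<le> a\<close>. So z is infinitesimal relative to a.\<close>
lemma band_eq_Int_polar_polar:
  fixes E :: "'a::vector_lattice set"
  assumes E: "ideal_in UNIV E" and arch: "\<And>x. x \<in> E \<Longrightarrow> archimedean_at x"
    and H: "band_in E H"
  shows "E \<inter> polar (polar H) = H"
proof (rule antisym)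
  have HE: "ideal_in E H" using H by (rule band_inD)
  have HU: "ideal_in UNIV H" using E HE by (rule ideal_in_trans)
  then show "H \<subseteq> E \<inter> polar (polar H)"
    using subset_polar_polar ideal_inD(2)[OF HE] by blast
  have pos: "a \<in> H" if a: "a \<in> E" "a \<in> polar (polar H)" "0 \<le> a" for a
  proof -
    let ?A = "{y \<in> H. y \<le> a}"
    have "isLub E ?A a"
    proof (rule isLubI2)
      show "isUb E ?A a" using a by (auto simp: isUb_def setle_def)
      show "a <=* Collect (isUb E ?A)"
      proof (intro setgeI ballI)
        fix u assume "u \<in> Collect (isUb E ?A)"
        then have u: "isUb E ?A u" by simp
        have ub: "y \<le> inf u a" if "y \<in> H" "y \<le> a" for y
          using isUbD[OF u, of y] that by simp
        define d where "d = a - inf u a"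
        have d0: "0 \<le> d" unfolding d_def by (simp del: diff_inf_eq_sup)
        have "d \<le> a"
          using ub[of 0] subspace_0[OF ideal_inD(1)[OF HU]] a
          by (simp add: d_def del: diff_inf_eq_sup)
        then have "d \<in> polar (polar H)"
          using ideal_inD(3)[OF ideal_in_polar _ a(2)] d0 a(3) by simp
        moreover have "d \<in> polar H"
          unfolding polar_iff
        proof
          fix h assume h: "h \<in> H"
          define z where "z = inf \<bar>d\<bar> \<bar>h\<bar>"
          have z0: "0 \<le> z" by (simp add: z_def)
          have zH: "z \<in> H" using ideal_inD(3)[OF HU _ h] z0 by (simp add: z_def)
          have "z \<le> d" using d0 by (simp add: z_def)
          have "real n *\<^sub>R z \<le> a" for n
          proof (induction n)
            case 0 then show ?case using a by simp
          next
            case (Suc n)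
            then have "real n *\<^sub>R z \<le> inf u a"
              using zH by (intro ub subspace_scale[OF ideal_inD(1)[OF HU]])
            then have "real n *\<^sub>R z + z \<le> inf u a + d" using \<open>z \<le> d\<close> by (rule add_mono)
            then show ?case by (simp add: d_def scaleR_add_left add.commute del: diff_inf_eq_sup)
          qed
          then have "z \<in> infinitesimals a" by (rule infinitesimalI_of_nat[OF z0])
          then show "inf \<bar>d\<bar> \<bar>h\<bar> = 0" using arch[OF a(1)] by (auto simp: archimedean_at_def z_def)
        qed
        ultimately have "inf \<bar>d\<bar> \<bar>d\<bar> = 0" by (rule polarD)
        then have "d = 0" by simp
        then have "inf u a = a" unfolding d_def right_minus_eq by (rule sym)
        then show "a \<le> u" by (simp only: inf.absorb_iff2)
      qed
    qed
    with H show ?thesis by (intro band_inD(2)[of E H ?A a]) auto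
  qed
  show "E \<inter> polar (polar H) \<subseteq> H"
  proof
    fix a assume a: "a \<in> E \<inter> polar (polar H)"
    then have "\<bar>a\<bar> \<in> H"
      using ideal_inD(3)[OF E, of "\<bar>a\<bar>" a] ideal_inD(3)[OF ideal_in_polar, of "\<bar>a\<bar>" a]
      by (intro pos) auto
    then show "a \<in> H" using ideal_inD(3)[OF HU, of a] by simp
  qed
qed

lemma band_hull_eq_Int_polar_polar:
  fixes E :: "'a::vector_lattice set"
  assumes E: "ideal_in UNIV E" and arch: "\<And>x. x \<in> E \<Longrightarrow> archimedean_at x" and C: "C \<subseteq> E"
  shows "band_in E hull C = E \<inter> polar (polar C)"
proof (rule antisym)
  show "band_in E hull C \<subseteq> E \<inter> polar (polar C)"
    by (intro hull_minimal band_in_Int_polar E Int_greatest C subset_polar_polar)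
  have "polar (polar C) \<subseteq> polar (polar (band_in E hull C))"
    by (intro polar_antimono hull_subset)
  then show "E \<inter> polar (polar C) \<subseteq> band_in E hull C"
    using band_eq_Int_polar_polar[OF E arch band_in_hull[OF E C]] by blast
qed

section \<open>Projection properties as pointwise conditions\<close>

text \<open>In each of the three characterisations the sets G range over subsets of F rather than E, so
  that the condition on x no longer mentions E.\<close>
lemma has_PPP_iff:
  fixes E :: "'a::vector_lattice set"
  assumes E: "ideal_in UNIV E"
  shows "has_PPP E \<longleftrightarrow> (\<forall>x\<in>E. \<forall>e. x \<in> polar_sum {e})"
proof -
  have "disjoint_compl E (disjoint_compl E {e}) = E \<inter> polar (polar {e})" for e
    unfolding disjoint_compl_eq[of E "{e}"] by (rule disjoint_compl_Int_polar[OF E])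
  then have "has_PPP E \<longleftrightarrow> (\<forall>e\<in>E. E \<subseteq> polar_sum {e})"
    by (simp only: has_PPP_def projection_band_in_polar_polar_iff[OF E])
  also have "\<dots> \<longleftrightarrow> (\<forall>x\<in>E. \<forall>e. x \<in> polar_sum {e})"
  proof (intro iffI ballI allI)
    fix x e assume *: "\<forall>e\<in>E. E \<subseteq> polar_sum {e}" and x: "x \<in> E"
    have "inf \<bar>e\<bar> \<bar>x\<bar> \<in> E" using ideal_inD(3)[OF E _ x] by simp
    with * have "E \<subseteq> polar_sum {inf \<bar>e\<bar> \<bar>x\<bar>}" by (rule bspec)
    with x have "x \<in> polar_sum ((\<lambda>e. inf \<bar>e\<bar> \<bar>x\<bar>) ` {e})" by (simp only: image_insert image_empty subset_iff)
    then show "x \<in> polar_sum {e}" by (rule polar_sum_truncate)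
  qed blast
  finally show ?thesis .
qed

lemma has_PP_iff:
  fixes E :: "'a::vector_lattice set"
  assumes E: "ideal_in UNIV E"
  shows "has_PP E \<longleftrightarrow> (\<forall>x\<in>E. archimedean_at x \<and> (\<forall>G. x \<in> polar_sum G))"
proof (intro iffI ballI conjI allI)
  fix x assume PP: "has_PP E" and x: "x \<in> E"
  show "archimedean_at x"
    using PP by (intro archimedean_at_if_projection_bands[OF E x])
      (simp add: has_PP_def band_in_hull[OF E])
  fix G
  have "projection_band_in E (E \<inter> polar (polar G))"
    using PP band_in_Int_polar[OF E] by (simp add: has_PP_def)
  with x show "x \<in> polar_sum G" using projection_band_in_polar_polar_iff[OF E] by blast
next
  assume *: "\<forall>x\<in>E. archimedean_at x \<and> (\<forall>G. x \<in> polar_sum G)"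
  show "has_PP E"
    unfolding has_PP_def
  proof (intro allI impI)
    fix H assume "band_in E H"
    then have "E \<inter> polar (polar H) = H" using * by (intro band_eq_Int_polar_polar[OF E]) auto
    moreover have "E \<subseteq> polar_sum H" using * by blast
    ultimately show "projection_band_in E H"
      using projection_band_in_polar_polar_iff[OF E, of H] by simp
  qed
qed

lemma has_sigma_PP_iff:
  fixes E :: "'a::vector_lattice set"
  assumes E: "ideal_in UNIV E"
  shows "has_sigma_PP E \<longleftrightarrow> (\<forall>x\<in>E. archimedean_at x \<and> (\<forall>G. countable G \<longrightarrow> x \<in> polar_sum G))"
proof (intro iffI ballI conjI allI impI)
  assume PP: "has_sigma_PP E"
  then have proj: "projection_band_in E (band_in E hull C)" if "countable C" "C \<subseteq> E" for C
    using that unfolding has_sigma_PP_def countably_generated_band_in_def by blast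
  show arch: "archimedean_at x" if x: "x \<in> E" for x
    by (intro archimedean_at_if_projection_bands[OF E x] proj) auto
  fix x and G :: "'a set" assume x: "x \<in> E" and G: "countable G"
  let ?T = "(\<lambda>e. inf \<bar>e\<bar> \<bar>x\<bar>) ` G"
  have "inf \<bar>e\<bar> \<bar>x\<bar> \<in> E" for e using ideal_inD(3)[OF E _ x] by simp
  then have T: "countable ?T" "?T \<subseteq> E" using G by auto
  then have "projection_band_in E (E \<inter> polar (polar ?T))"
    using proj[OF T] band_hull_eq_Int_polar_polar[OF E arch T(2)] by simp
  with x have "x \<in> polar_sum ?T" using projection_band_in_polar_polar_iff[OF E] by blast
  then show "x \<in> polar_sum G" by (rule polar_sum_truncate)
next
  assume *: "\<forall>x\<in>E. archimedean_at x \<and> (\<forall>G. countable G \<longrightarrow> x \<in> polar_sum G)"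
  show "has_sigma_PP E"
    unfolding has_sigma_PP_def countably_generated_band_in_def
  proof (intro allI impI, elim exE conjE)
    fix H C assume C: "countable C" "C \<subseteq> E" and H: "H = band_in E hull C"
    have "E \<subseteq> polar_sum C" using * C by blast
    then show "projection_band_in E H"
      unfolding H using * projection_band_in_polar_polar_iff[OF E]
      by (subst band_hull_eq_Int_polar_polar[OF E _ C(2)]) auto
  qed
qed

lemma ideal_in_polar_sums:
  "ideal_in UNIV {x :: 'a::vector_lattice. \<forall>G. P G \<longrightarrow> x \<in> polar_sum G}"
proof (rule ideal_in_UNIV_I)
  note sub = ideal_inD(1)[OF ideal_in_polar_sum]
  show "subspace {x :: 'a. \<forall>G. P G \<longrightarrow> x \<in> polar_sum G}"
    by (intro subspaceI) (auto intro: subspace_0 subspace_add subspace_scale sub)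
  fix f h :: 'a assume "h \<in> {x. \<forall>G. P G \<longrightarrow> x \<in> polar_sum G}" and fh: "\<bar>f\<bar> \<le> \<bar>h\<bar>"
  then show "f \<in> {x. \<forall>G. P G \<longrightarrow> x \<in> polar_sum G}"
    using ideal_inD(3)[OF ideal_in_polar_sum UNIV_I _ fh] by simp
qed

text \<open>Singletons are admitted for G because the addition step splits along \<open>(\<bar>x\<bar> - \<bar>y\<bar>)\<^sup>+\<close>.\<close>
lemma ideal_in_archimedean_polar_sums:
  fixes P :: "'a::vector_lattice set \<Rightarrow> bool"
  assumes P: "\<And>e. P {e}"
  shows "ideal_in UNIV {x. archimedean_at x \<and> (\<forall>G. P G \<longrightarrow> x \<in> polar_sum G)}"
    (is "ideal_in UNIV ?R")
proof -
  define S where "S = {x. \<forall>G. P G \<longrightarrow> x \<in> polar_sum G}"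
  have S: "ideal_in UNIV S" unfolding S_def by (rule ideal_in_polar_sums)
  note sub = ideal_inD(1)[OF S]
  have R: "?R = {x. archimedean_at x \<and> x \<in> S}" by (simp add: S_def)
  have arch_le: "archimedean_at f" if "0 < c" "\<bar>f\<bar> \<le> c *\<^sub>R \<bar>h\<bar>" "archimedean_at h" for c and f h :: 'a
    using infinitesimals_scaleR_subset[OF that(1,2)] that(3)
    unfolding archimedean_at_def by (rule subset_trans)
  show ?thesis
    unfolding R
  proof (rule ideal_in_UNIV_I)
    let ?R = "{x. archimedean_at x \<and> x \<in> S}"
    show "subspace ?R"
    proof (rule subspaceI)
      have "e = 0" if "e \<in> infinitesimals (0 :: 'a)" for e
        using abs_scaleR_infinitesimal_le[OF that, of 1] by simp
      then have "archimedean_at (0 :: 'a)" unfolding archimedean_at_def by blast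
      then show "0 \<in> ?R" using subspace_0[OF sub] by simp
    next
      fix x y assume "x \<in> ?R" "y \<in> ?R"
      then have x: "archimedean_at x" "x \<in> S" and y: "archimedean_at y" "y \<in> S" by simp_all
      have sum: "x + y \<in> S" using x(2) y(2) by (rule subspace_add[OF sub])
      then have "x + y \<in> polar_sum {pprt (\<bar>x\<bar> - \<bar>y\<bar>)}" using P by (simp add: S_def)
      with x(1) y(1) have "archimedean_at (x + y)" by (rule archimedean_at_add)
      with sum show "x + y \<in> ?R" by simp
    next
      fix c x assume "x \<in> ?R"
      then have x: "archimedean_at x" "x \<in> S" by simp_all
      have "\<bar>c *\<^sub>R x\<bar> \<le> (\<bar>c\<bar> + 1) *\<^sub>R \<bar>x\<bar>"
        unfolding abs_scaleR_vector_lattice by (intro scaleR_right_mono) auto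
      then have "archimedean_at (c *\<^sub>R x)"
        using x(1) by (rule arch_le[rotated]) simp
      then show "c *\<^sub>R x \<in> ?R" using subspace_scale[OF sub x(2)] by simp
    qed
    fix f h assume h: "h \<in> ?R" and fh: "\<bar>f\<bar> \<le> \<bar>h\<bar>"
    have "archimedean_at f" using arch_le[of 1 f h] fh h by simp
    moreover have "f \<in> S" using ideal_inD(3)[OF S UNIV_I _ fh] h by simp
    ultimately show "f \<in> ?R" by simp
  qed
qed

text \<open>The principle by which a property that is tested elementwise passes from the principal
  ideals to the set of their generators.\<close>
lemma ideal_of_generators:
  fixes R :: "'a::vector_lattice set"
  assumes char: "\<And>E. ideal_in UNIV E \<Longrightarrow> has E \<longleftrightarrow> E \<subseteq> R" and R: "ideal_in UNIV R"
  shows "ideal_in UNIV {h. has (principal_ideal h)} \<and> has {h. has (principal_ideal h)}"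
proof -
  have "{h. has (principal_ideal h)} = R"
    using char[OF ideal_in_principal_ideal] principal_ideal_subset_iff[OF R] by auto
  with char[OF R] R show ?thesis by simp
qed

theorem corollary3p4:
  shows "(ideal_in UNIV {h :: 'a::vector_lattice. has_PPP (principal_ideal h)} \<and>
          has_PPP {h :: 'a. has_PPP (principal_ideal h)}) \<and>
         (ideal_in UNIV {h :: 'a. has_PP (principal_ideal h)} \<and>
          has_PP {h :: 'a. has_PP (principal_ideal h)}) \<and>
         (ideal_in UNIV {h :: 'a. has_sigma_PP (principal_ideal h)} \<and>
          has_sigma_PP {h :: 'a. has_sigma_PP (principal_ideal h)})"
proof (intro conjI[of "_ \<and> _" "_ \<and> _"])
  have "ideal_in UNIV {x :: 'a. \<forall>e. x \<in> polar_sum {e}}"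
  proof -
    \<comment> \<open>the instance of the general fact for the class of singletons\<close>
    have "{x :: 'a. \<forall>e. x \<in> polar_sum {e}} = {x. \<forall>G. (\<exists>e. G = {e}) \<longrightarrow> x \<in> polar_sum G}"
      by blast
    then show ?thesis by (simp only: ideal_in_polar_sums)
  qed
  then show "ideal_in UNIV {h :: 'a. has_PPP (principal_ideal h)} \<and>
        has_PPP {h :: 'a. has_PPP (principal_ideal h)}"
    by (rule ideal_of_generators[rotated]) (auto simp: has_PPP_iff)
  have "ideal_in UNIV {x :: 'a. archimedean_at x \<and> (\<forall>G. x \<in> polar_sum G)}"
    using ideal_in_archimedean_polar_sums[of "\<lambda>_. True"] by simp
  then show "ideal_in UNIV {h :: 'a. has_PP (principal_ideal h)} \<and>
        has_PP {h :: 'a. has_PP (principal_ideal h)}"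
    by (rule ideal_of_generators[rotated]) (auto simp: has_PP_iff)
  have "ideal_in UNIV {x :: 'a. archimedean_at x \<and> (\<forall>G. countable G \<longrightarrow> x \<in> polar_sum G)}"
    by (rule ideal_in_archimedean_polar_sums) simp
  then show "ideal_in UNIV {h :: 'a. has_sigma_PP (principal_ideal h)} \<and>
        has_sigma_PP {h :: 'a. has_sigma_PP (principal_ideal h)}"
    by (rule ideal_of_generators[rotated]) (auto simp: has_sigma_PP_iff)
qed

end
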